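(* Let $\mathcal{G}$ be any Stackelberg game and $\mathcal{H} \subseteq [K]^{\mathcal{Z}}$ any nonempty hypothesis class. Then for every $T$ and every sequence of contexts and follower types $(\mathbf{z}_1, f_1), \ldots, (\mathbf{z}_T, f_T)$ realizable by $\mathcal{H}$, the regret of the algorithm SSOA satisfies $$R(T) = \sum_{t=1}^T r(\mathbf{z}_t, \mathbf{x}_t, f_t) \le \mathrm{SLdim}_{\mathcal{G}}(\mathcal{H}).$$
   Context: Stackelberg game. A (contextual) Stackelberg game is a tuple $\mathcal{G} = (\mathcal{A}, \mathcal{A}_f, \mathcal{Z}, u, u_{f^{(1)}}, \ldots, u_{f^{(K)}})$, where $\mathcal{A}$ and $\mathcal{A}_f$ are the finite nonempty action sets of the leader and the follower, $\mathcal{Z} \subseteq \mathbb{R}^d$ is the set of contexts, $u : \mathcal{Z} \times \mathcal{A} \times \mathcal{A}_f \to [0,1]$ is the leader's utility, and $u_{f^{(i)}} : \mathcal{Z} \times \mathcal{A} \times \mathcal{A}_f \to [0,1]$ is the utility of a follower of type $f^{(i)}$, $i \in [K] = \{1,\ldots,K\}$. $\Delta(\mathcal{A})$ is the probability simplex over $\mathcal{A}$ (leader mixed strategies), and $u(\mathbf{z}, \mathbf{x}, a_f) := \sum_{a_l \in \mathcal{A}} \mathbf{x}[a_l]\, u(\mathbf{z}, a_l, a_f)$ for $\mathbf{x} \in \Delta(\mathcal{A})$. The best response of type $f^{(i)}$ is $b_{f^{(i)}}(\mathbf{z}, \mathbf{x}) \in \arg\max_{a_f \in \mathcal{A}_f}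 \sum_{a_l} \mathbf{x}[a_l]\, u_{f^{(i)}}(\mathbf{z}, a_l, a_f)$, ties being broken by a fixed, known, deterministic order on $\mathcal{A}_f$. The leader's loss is $r(\mathbf{z}, \mathbf{x}, f^{(i)}) := \sup_{\mathbf{x}' \in \Delta(\mathcal{A})} u(\mathbf{z}, \mathbf{x}', b_{f^{(i)}}(\mathbf{z}, \mathbf{x}')) - u(\mathbf{z}, \mathbf{x}, b_{f^{(i)}}(\mathbf{z}, \mathbf{x}))$. Online protocol. The leader knows $\mathcal{G}$ and $\mathcal{H}$. In each round $t = 1, \ldots, T$, a context $\mathbf{z}_t \in \mathcal{Z}$ is revealed, the leader commits to $\mathbf{x}_t \in \Delta(\mathcal{A})$, and then the follower's type $f_t$ is revealed. A sequence is realizable by $\mathcal{H}$ if there is $h^* \in \mathcal{H}$ with $f_t = f^{(h^*(\mathbf{z}_t))}$ for all $t$. Stackelberg Littlestone (SL) tree. A finite-depth rooted tree in which each internal node is labeled with an element of $\mathcal{Z}$ and each edge corresponds to a label in $[K]$ (distinct edges leaving the same node have distinct labels). Nodes are indexed by the sequence $s$ of edge labels on the path from the root (the root is $\varnothing$), and $\mathbf{z}_s$ is the context at node $s$. Each node $s$ has a weight $\rho_s$: $\rho_s = 0$ if $s$ is a leaf, and otherwise $$\rho_s = \inf_{\mathbf{x} \in \Delta(\mathcal{A})} \max_{j \in [K]:\, sj \text{ is a child of } s} \left( r(\mathbf{z}_s, \mathbf{x}, f^{(j)}) + \rho_{sj} \right).$$ The tree is shattered by $\mathcal{H}$ under $\mathcal{G}$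 if for every root-to-leaf path there is $h \in \mathcal{H}$ such that, for every internal node $\mathbf{z}$ on the path, the label of the edge of the path leaving $\mathbf{z}$ is $h(\mathbf{z})$. $\mathrm{SLdim}_{\mathcal{G}}(\mathcal{H}) := \sup\{\kappa \ge 0 : \text{there exists an SL tree shattered by } \mathcal{H} \text{ under } \mathcal{G} \text{ with root node weight } \kappa\} \in [0,\infty]$. Notation. For $V \subseteq \mathcal{H}$: $V(\mathbf{z}) = \{ i \in [K] : \exists h \in V,\ h(\mathbf{z}) = i\}$ and $V^{(\mathbf{z} \to i)} = \{h \in V : h(\mathbf{z}) = i\}$. Algorithm SSOA. Initialize $V_1 = \mathcal{H}$. In round $t$: observe $\mathbf{z}_t$; play $$\mathbf{x}_t \in \arg\inf_{\mathbf{x} \in \Delta(\mathcal{A})} \max_{j \in V_t(\mathbf{z}_t)} \left( r(\mathbf{z}_t, \mathbf{x}, f^{(j)}) + \mathrm{SLdim}_{\mathcal{G}}\big(V_t^{(\mathbf{z}_t \to j)}\big) \right);$$ observe the follower type $f_t = f^{(i_t)}$ and set $V_{t+1} = V_t^{(\mathbf{z}_t \to i_t)}$. Standing convention: the leader is assumed to be able to optimize exactly over the whole simplex, i.e. the infimum defining $\mathbf{x}_t$ is assumed to be attained in every round. *)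

theory Defs
  imports "HOL-Analysis.Analysis"
begin

text \<open>
  The action sets are the (finite, nonempty) types \<open>'a\<close> (leader) and \<open>'f\<close> (follower). The
  linear order of \<open>'f\<close> is the tie-breaking order. Follower types are identified with
  their indices \<open>1, \<dots>, num_types G\<close>.
\<close>

record ('d::finite, 'a, 'f) stackelberg_game =
  contexts :: "(real ^ 'd) set"
  num_types :: nat
  leader_util :: "real ^ 'd \<Rightarrow> 'a \<Rightarrow> 'f \<Rightarrow> real"
  follower_util :: "nat \<Rightarrow> real ^ 'd \<Rightarrow> 'a \<Rightarrow> 'f \<Rightarrow> real"

definition valid_game :: "('d::finite, 'a, 'f) stackelberg_game \<Rightarrow> bool" where
  "valid_game G \<longleftrightarrow>
     (\<forall>z\<in>contexts G. \<forall>a b. leader_util G z a b \<in> {0..1}) \<and>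
     (\<forall>i\<in>{1..num_types G}. \<forall>z\<in>contexts G. \<forall>a b. follower_util G i z a b \<in> {0..1})"

definition mixed :: "(real ^ 'a::finite) set" where
  "mixed = {x. (\<forall>a. 0 \<le> x $ a) \<and> (\<Sum>a\<in>UNIV. x $ a) = 1}"

definition leader_exp_util ::
    "('d::finite, 'a::finite, 'f) stackelberg_game \<Rightarrow> real ^ 'd \<Rightarrow> real ^ 'a \<Rightarrow> 'f \<Rightarrow> real" where
  "leader_exp_util G z x b = (\<Sum>a\<in>UNIV. x $ a * leader_util G z a b)"

definition follower_exp_util ::
    "('d::finite, 'a::finite, 'f) stackelberg_game \<Rightarrow> nat \<Rightarrow> real ^ 'd \<Rightarrow> real ^ 'a \<Rightarrow> 'f \<Rightarrow> real" where
  "follower_exp_util G i z x b = (\<Sum>a\<in>UNIV. x $ a * follower_util G i z a b)"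

definition best_response ::
    "('d::finite, 'a::finite, 'f::{finite,linorder}) stackelberg_game \<Rightarrow> nat \<Rightarrow> real ^ 'd \<Rightarrow> real ^ 'a \<Rightarrow> 'f" where
  "best_response G i z x = Min {b. is_arg_max (follower_exp_util G i z x) (\<lambda>_. True) b}"

definition loss ::
    "('d::finite, 'a::finite, 'f::{finite,linorder}) stackelberg_game \<Rightarrow> real ^ 'd \<Rightarrow> real ^ 'a \<Rightarrow> nat \<Rightarrow> real" where
  "loss G z x i =
     (SUP x'\<in>mixed. leader_exp_util G z x' (best_response G i z x'))
       - leader_exp_util G z x (best_response G i z x)"


text \<open>
  The children of a node are a partial map from edge labels to subtrees, so edges leaving a node
  have distinct labels. Every branch is finite by well-foundedness of the datatype; since
  \<open>sl_tree\<close> below makes branching finite, the depth is finite too.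
\<close>

datatype 'z tree = Leaf | Node 'z "nat \<rightharpoonup> 'z tree"

inductive sl_tree :: "('d::finite, 'a, 'f) stackelberg_game \<Rightarrow> (real ^ 'd) tree \<Rightarrow> bool"
  for G where
  "sl_tree G Leaf"
| "z \<in> contexts G \<Longrightarrow> dom c \<noteq> {} \<Longrightarrow> dom c \<subseteq> {1..num_types G} \<Longrightarrow>
     (\<And>t. t \<in> ran c \<Longrightarrow> sl_tree G t) \<Longrightarrow> sl_tree G (Node z c)"

primrec weight ::
    "('d::finite, 'a::finite, 'f::{finite,linorder}) stackelberg_game \<Rightarrow> (real ^ 'd) tree \<Rightarrow> real" where
  "weight G Leaf = 0"
| "weight G (Node z c) =
     (INF x\<in>mixed. Max {loss G z x j + \<rho> | j \<rho>. map_option (weight G) (c j) = Some \<rho>})"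

text \<open>A root-to-leaf path is given by its internal nodes' contexts with the outgoing edge labels.\<close>

inductive root_leaf_path :: "'z tree \<Rightarrow> ('z \<times> nat) list \<Rightarrow> bool" where
  "root_leaf_path Leaf []"
| "c j = Some t \<Longrightarrow> root_leaf_path t p \<Longrightarrow> root_leaf_path (Node z c) ((z, j) # p)"

definition shattered :: "('z \<Rightarrow> nat) set \<Rightarrow> 'z tree \<Rightarrow> bool" where
  "shattered V t \<longleftrightarrow> (\<forall>p. root_leaf_path t p \<longrightarrow> (\<exists>h\<in>V. \<forall>(z, j)\<in>set p. h z = j))"

text \<open>
  For nonempty \<open>V\<close> the value lies in \<open>[0, \<infinity>]\<close>, as \<open>Leaf\<close> is shattered with weight 0. The
  empty class shatters no tree and gets \<open>Sup {} = - \<infinity>\<close>, but its dimension is never used: the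
  algorithm only evaluates \<open>SLdim\<close> at \<open>restrict_to V z j\<close> with \<open>j \<in> labels G V z\<close>.
\<close>

definition SLdim ::
    "('d::finite, 'a::finite, 'f::{finite,linorder}) stackelberg_game \<Rightarrow> (real ^ 'd \<Rightarrow> nat) set \<Rightarrow> ereal" where
  "SLdim G V = Sup {ereal \<kappa> | \<kappa>. 0 \<le> \<kappa> \<and> (\<exists>t. sl_tree G t \<and> shattered V t \<and> weight G t = \<kappa>)}"


definition labels ::
    "('d::finite, 'a, 'f) stackelberg_game \<Rightarrow> (real ^ 'd \<Rightarrow> nat) set \<Rightarrow> real ^ 'd \<Rightarrow> nat set" where
  "labels G V z = {i \<in> {1..num_types G}. \<exists>h\<in>V. h z = i}"

definition restrict_to :: "('z \<Rightarrow> nat) set \<Rightarrow> 'z \<Rightarrow> nat \<Rightarrow> ('z \<Rightarrow> nat) set" where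
  "restrict_to V z i = {h \<in> V. h z = i}"

text \<open>Rounds are numbered \<open>0, \<dots>, T - 1\<close>: round \<open>t\<close> here is round \<open>t + 1\<close> of the protocol.\<close>

definition realizable ::
    "('d::finite, 'a, 'f) stackelberg_game \<Rightarrow> (real ^ 'd \<Rightarrow> nat) set \<Rightarrow> nat \<Rightarrow>
     (nat \<Rightarrow> real ^ 'd) \<Rightarrow> (nat \<Rightarrow> nat) \<Rightarrow> bool" where
  "realizable G H T z i \<longleftrightarrow>
     (\<forall>t<T. z t \<in> contexts G) \<and> (\<exists>h\<in>H. \<forall>t<T. i t = h (z t))"

primrec version_space ::
    "('z \<Rightarrow> nat) set \<Rightarrow> (nat \<Rightarrow> 'z) \<Rightarrow> (nat \<Rightarrow> nat) \<Rightarrow> nat \<Rightarrow> ('z \<Rightarrow> nat) set" where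
  "version_space H z i 0 = H"
| "version_space H z i (Suc t) = restrict_to (version_space H z i t) (z t) (i t)"

definition ssoa_objective ::
    "('d::finite, 'a::finite, 'f::{finite,linorder}) stackelberg_game \<Rightarrow> (real ^ 'd \<Rightarrow> nat) set \<Rightarrow>
     real ^ 'd \<Rightarrow> real ^ 'a \<Rightarrow> ereal" where
  "ssoa_objective G V z x =
     Max ((\<lambda>j. ereal (loss G z x j) + SLdim G (restrict_to V z j)) ` labels G V z)"

text \<open>
  \<open>x\<close> is a sequence of plays that SSOA may produce; any choice among several minimizers is
  allowed, and the minimum over the simplex is attained in every round by assumption.
\<close>

definition ssoa_play ::
    "('d::finite, 'a::finite, 'f::{finite,linorder}) stackelberg_game \<Rightarrow> (real ^ 'd \<Rightarrow> nat) set \<Rightarrow> nat \<Rightarrow>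
     (nat \<Rightarrow> real ^ 'd) \<Rightarrow> (nat \<Rightarrow> nat) \<Rightarrow> (nat \<Rightarrow> real ^ 'a) \<Rightarrow> bool" where
  "ssoa_play G H T z i x \<longleftrightarrow>
     (\<forall>t<T. is_arg_min (ssoa_objective G (version_space H z i t) (z t)) (\<lambda>y. y \<in> mixed) (x t))"

definition regret ::
    "('d::finite, 'a::finite, 'f::{finite,linorder}) stackelberg_game \<Rightarrow> nat \<Rightarrow>
     (nat \<Rightarrow> real ^ 'd) \<Rightarrow> (nat \<Rightarrow> nat) \<Rightarrow> (nat \<Rightarrow> real ^ 'a) \<Rightarrow> real" where
  "regret G T z i x = (\<Sum>t<T. loss G (z t) (x t) (i t))"

end

theory Submission
  imports Defs
begin

text \<open>
  Gluing near-optimal trees for the restricted classes below a root labelled with the current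
  context gives a tree shattered by the current version space. Its weight shows that the minimal
  value of the SSOA objective is at most the dimension of the version space. Hence
  the regret so far plus the dimension of the version space never increases.
\<close>

lemma leader_exp_util_le_1:
  assumes "valid_game G" "z \<in> contexts G" "x \<in> mixed"
  shows "leader_exp_util G z x b \<le> 1"
proof -
  have "leader_exp_util G z x b \<le> (\<Sum>a\<in>UNIV. x $ a * 1)"
    unfolding leader_exp_util_def
    using assms by (intro sum_mono mult_left_mono) (auto simp: valid_game_def mixed_def)
  also have "\<dots> = 1"
    using assms by (simp add: mixed_def)
  finally show ?thesis .
qed

text \<open>Utilities bounded by 1 make the supremum in \<open>loss\<close> a genuine least upper
  bound, and \<open>x\<close> itself is one of its competitors.\<close>

lemma loss_nonneg:
  assumes "valid_game G" "z \<in> contexts G" "x \<in> mixed"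
  shows "0 \<le> loss G z x i"
proof -
  have "bdd_above ((\<lambda>y. leader_exp_util G z y (best_response G i z y)) ` mixed)"
    using leader_exp_util_le_1[OF assms(1,2)] by (intro bdd_aboveI2[of _ _ 1])
  from cSUP_upper[OF assms(3) this] show ?thesis
    by (simp add: loss_def)
qed

lemma SLdim_nonneg:
  assumes "V \<noteq> {}"
  shows "0 \<le> SLdim G V"
proof -
  have "shattered V Leaf"
    using assms by (auto simp: shattered_def elim: root_leaf_path.cases)
  then have "ereal 0 \<le> SLdim G V"
    unfolding SLdim_def by (intro Sup_upper) (auto intro!: exI[of _ Leaf] sl_tree.intros)
  then show ?thesis
    by (simp add: zero_ereal_def)
qed

lemma weight_le_SLdim:
  assumes "sl_tree G t" "shattered V t" "0 \<le> weight G t"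
  shows "ereal (weight G t) \<le> SLdim G V"
  unfolding SLdim_def using assms by (intro Sup_upper) auto

lemma SLdim_mono:
  assumes "V \<subseteq> W"
  shows "SLdim G V \<le> SLdim G W"
proof -
  have "shattered W t" if "shattered V t" for t
    using that assms unfolding shattered_def by blast
  then show ?thesis
    unfolding SLdim_def by (intro Sup_subset_mono) auto
qed

text \<open>The supremum defining \<open>SLdim\<close> need not be attained, so trees are chosen
  with weight strictly above any smaller real.\<close>

lemma SLdim_approx:
  assumes "ereal r < SLdim G V"
  obtains t where "sl_tree G t" "shattered V t" "0 \<le> weight G t" "r < weight G t"
  using assms unfolding SLdim_def less_Sup_iff by auto

text \<open>A path below the root starts with some edge \<open>(z, j)\<close>. The hypothesis that
  realizes its remainder comes from \<open>restrict_to V z j\<close>, so it also agrees with that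
  first edge and lies in \<open>V\<close>.\<close>

lemma shattered_Node:
  assumes "\<And>j t. c j = Some t \<Longrightarrow> shattered (restrict_to V z j) t"
  shows "shattered V (Node z c)"
  unfolding shattered_def
proof (intro allI impI)
  fix p
  assume "root_leaf_path (Node z c) p"
  then obtain j t q where p: "p = (z, j) # q" and "c j = Some t" "root_leaf_path t q"
    by (auto elim: root_leaf_path.cases)
  then obtain h where "h \<in> restrict_to V z j" "\<forall>(z, j)\<in>set q. h z = j"
    using assms unfolding shattered_def by blast
  then show "\<exists>h\<in>V. \<forall>(z, j)\<in>set p. h z = j"
    unfolding p restrict_to_def by auto
qed

text \<open>Turns the comprehension over a partial map into an image of the label set
  \<open>J\<close>, the form in which finite maxima are handled below.\<close>

lemma weight_Node:
  assumes "\<And>j. c j = (if j \<in> J then Some (t j) else None)"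
  shows "weight G (Node z c) =
    (INF x\<in>mixed. Max ((\<lambda>j. loss G z x j + weight G (t j)) ` J))"
proof -
  have "{loss G z x j + \<rho> | j \<rho>. map_option (weight G) (c j) = Some \<rho>} =
      (\<lambda>j. loss G z x j + weight G (t j)) ` J" for x
    by (auto simp: assms split: if_splits)
  then show ?thesis
    by simp
qed

text \<open>The objective has the same inf-max form as the weight of a root, with dimensions in
  place of the weights of the children; near-optimal children make the two agree up to an
  arbitrarily small error.\<close>

lemma ssoa_objective_arg_min_le_SLdim:
  assumes valid: "valid_game G" and z: "z \<in> contexts G" and J: "labels G V z \<noteq> {}"
    and y: "is_arg_min (ssoa_objective G V z) (\<lambda>y. y \<in> mixed) y"
  shows "ssoa_objective G V z y \<le> SLdim G V"
proof (cases "SLdim G V = \<infinity>")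
  \<comment> \<open>By monotonicity a finite dimension of \<open>V\<close> makes those of all
    restricted classes finite, so the objective can be treated as a real number.\<close>
  case False
  define J where "J = labels G V z"
  have fin: "finite J" and ne: "J \<noteq> {}" and sub: "J \<subseteq> {1..num_types G}"
    using assms by (auto simp: J_def labels_def)
  define s where "s = (\<lambda>j. real_of_ereal (SLdim G (restrict_to V z j)))"
  have s: "SLdim G (restrict_to V z j) = ereal (s j)" if "j \<in> J" for j
  proof -
    have "restrict_to V z j \<noteq> {}" "restrict_to V z j \<subseteq> V"
      using that by (auto simp: J_def labels_def restrict_to_def)
    then have "0 \<le> SLdim G (restrict_to V z j)" "SLdim G (restrict_to V z j) \<le> SLdim G V"
      using SLdim_nonneg SLdim_mono by blast+
    then show ?thesis
      using False by (auto simp: s_def ereal_real)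
  qed
  define \<phi> where "\<phi> = (\<lambda>x. Max ((\<lambda>j. loss G z x j + s j) ` J))"
  have obj: "ssoa_objective G V z x = ereal (\<phi> x)" for x
  proof -
    have "ssoa_objective G V z x = Max (ereal ` (\<lambda>j. loss G z x j + s j) ` J)"
      unfolding ssoa_objective_def J_def[symmetric] image_image
      by (intro arg_cong[of _ _ Max] image_cong) (auto simp: s)
    also have "\<dots> = ereal (\<phi> x)"
      unfolding \<phi>_def using fin ne by (intro mono_Max_commute[symmetric]) (auto simp: mono_def)
    finally show ?thesis .
  qed
  have y_min: "\<phi> y \<le> \<phi> x" if "x \<in> mixed" for x
    using y that by (auto simp: is_arg_min_linorder obj)
  have mixed: "y \<in> mixed"
    using y by (simp add: is_arg_min_def)
  show ?thesis
  proof (rule ereal_le_epsilon2)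
    fix e :: real
    assume e: "0 < e"
    have "\<exists>t. sl_tree G t \<and> shattered (restrict_to V z j) t \<and>
        0 \<le> weight G t \<and> s j - e < weight G t" if "j \<in> J" for j
      using SLdim_approx[of "s j - e" G "restrict_to V z j"] s[OF that] e by auto
    then obtain t where t: "\<And>j. j \<in> J \<Longrightarrow> sl_tree G (t j) \<and> shattered (restrict_to V z j) (t j) \<and>
        0 \<le> weight G (t j) \<and> s j - e < weight G (t j)"
      by metis
    define c where "c = (\<lambda>j. if j \<in> J then Some (t j) else None)"
    have c: "c j = (if j \<in> J then Some (t j) else None)" for j
      by (simp add: c_def)
    have "sl_tree G (Node z c)"
      using z ne sub t by (intro sl_tree.intros) (auto simp: c dom_def ran_def split: if_splits)
    moreover have "shattered V (Node z c)"
      using t by (intro shattered_Node) (auto simp: c split: if_splits)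
    \<comment> \<open>To bound the infimum of maxima from below, one good child per mixed strategy
      is enough, and that child may depend on the strategy.\<close>
    moreover have weight_ge: "r \<le> weight G (Node z c)"
      if bound: "\<And>x. x \<in> mixed \<Longrightarrow> \<exists>j\<in>J. r \<le> loss G z x j + weight G (t j)" for r
      unfolding weight_Node[OF c]
    proof (rule cINF_greatest)
      show "mixed \<noteq> ({} :: (real ^ 'b) set)"
        using mixed by blast
      show "r \<le> Max ((\<lambda>j. loss G z x j + weight G (t j)) ` J)" if "x \<in> mixed" for x
        using bound[OF that] fin ne by (simp add: Max_ge_iff)
    qed
    \<comment> \<open>\<open>SLdim\<close> only counts trees of nonnegative weight; here any child
      gives the bound, losses and child weights being nonnegative.\<close>
    moreover have "0 \<le> weight G (Node z c)"
      using ne t loss_nonneg[OF valid z] by (intro weight_ge) (meson add_nonneg_nonneg ex_in_conv)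
    ultimately have "ereal (weight G (Node z c)) \<le> SLdim G V"
      by (intro weight_le_SLdim)
    moreover have "\<phi> y - e \<le> weight G (Node z c)"
    proof (rule weight_ge)
      fix x :: "real ^ 'b"
      assume x: "x \<in> mixed"
      \<comment> \<open>The good child is a label attaining the maximum in \<open>\<phi> x\<close>:
        its tree loses less than \<open>e\<close> against \<open>s j\<close>, and
        \<open>\<phi> y \<le> \<phi> x\<close>.\<close>
      have "\<phi> x \<in> (\<lambda>j. loss G z x j + s j) ` J"
        unfolding \<phi>_def using fin ne by (intro Max_in) auto
      then obtain j where "j \<in> J" "\<phi> x = loss G z x j + s j"
        by auto
      then show "\<exists>j\<in>J. \<phi> y - e \<le> loss G z x j + weight G (t j)"
        using t[of j] y_min[OF x] by (intro bexI[of _ j]) auto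
    qed
    ultimately have "ereal (\<phi> y - e) \<le> SLdim G V"
      by (meson ereal_less_eq(3) order_trans)
    then show "ssoa_objective G V z y \<le> SLdim G V + ereal e"
      by (cases "SLdim G V") (auto simp: obj)
  qed
qed simp

text \<open>Potential argument by induction on the rounds. That \<open>h\<close> survives belongs to
  the invariant: it makes the next revealed label one over which SSOA maximizes.\<close>

lemma regret_add_SLdim_le:
  assumes valid: "valid_game G" and h: "h \<in> H" "h \<in> contexts G \<rightarrow> {1..num_types G}"
    and z: "\<forall>t<T. z t \<in> contexts G" and i: "\<forall>t<T. i t = h (z t)"
    and play: "ssoa_play G H T z i x" and "n \<le> T"
  shows "h \<in> version_space H z i n \<and>
    ereal (regret G n z i x) + SLdim G (version_space H z i n) \<le> SLdim G H"
  using \<open>n \<le> T\<close>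
proof (induction n)
  case 0
  show ?case
    using h by (simp add: regret_def zero_ereal_def[symmetric])
next
  case (Suc n)
  define V where "V = version_space H z i n"
  have n: "n < T" and hV: "h \<in> V"
    and IH: "ereal (regret G n z i x) + SLdim G V \<le> SLdim G H"
    using Suc by (auto simp: V_def)
  have label: "i n \<in> labels G V (z n)"
    using n hV h z i by (auto simp: labels_def)
  \<comment> \<open>The loss of the round plus the dimension after it is just the term of the
    revealed label in the maximum.\<close>
  have "ereal (loss G (z n) (x n) (i n)) + SLdim G (restrict_to V (z n) (i n))
      \<le> ssoa_objective G V (z n) (x n)"
    unfolding ssoa_objective_def using label by (intro Max_ge) (auto simp: labels_def)
  also have "\<dots> \<le> SLdim G V"
    using n z label play
    by (intro ssoa_objective_arg_min_le_SLdim[OF valid]) (auto simp: ssoa_play_def V_def)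
  finally have "ereal (regret G n z i x) +
      (ereal (loss G (z n) (x n) (i n)) + SLdim G (restrict_to V (z n) (i n))) \<le> SLdim G H"
    using IH add_left_mono order_trans by blast
  then show ?case
    using hV n i by (simp add: regret_def V_def[symmetric] restrict_to_def add.assoc[symmetric])
qed

theorem theorem3p9:
  fixes G :: "('d::finite, 'a::finite, 'f::{finite,linorder}) stackelberg_game"
    and H :: "(real ^ 'd \<Rightarrow> nat) set"
    and T :: nat
    and z :: "nat \<Rightarrow> real ^ 'd"
    and i :: "nat \<Rightarrow> nat"
    and x :: "nat \<Rightarrow> real ^ 'a"
  assumes "valid_game G"
    and "H \<subseteq> contexts G \<rightarrow>\<^sub>E {1..num_types G}"
    and "H \<noteq> {}"
    and "realizable G H T z i"
    and "ssoa_play G H T z i x"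
  shows "ereal (regret G T z i x) \<le> SLdim G H"
proof -
  obtain h where h: "h \<in> H" and z: "\<forall>t<T. z t \<in> contexts G" and i: "\<forall>t<T. i t = h (z t)"
    using assms(4) by (auto simp: realizable_def)
  have "h \<in> contexts G \<rightarrow> {1..num_types G}"
    using h assms(2) by (auto simp: PiE_def)
  then have le: "ereal (regret G T z i x) + SLdim G (version_space H z i T) \<le> SLdim G H"
    and "h \<in> version_space H z i T"
    using regret_add_SLdim_le[OF assms(1) h _ z i assms(5) order_refl] by blast+
  then have "0 \<le> SLdim G (version_space H z i T)"
    by (intro SLdim_nonneg) auto
  then have "ereal (regret G T z i x) \<le> ereal (regret G T z i x) + SLdim G (version_space H z i T)"
    using add_left_mono by fastforce
  with le show ?thesis
    by (rule order_trans[rotated])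
qed

end
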